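(* Let $\alpha\in\mathbb{R}$ with $0<\alpha\le 1$, and let $F_\alpha:\mathbb{R}^2\to\mathbb{R}^2$, $F_\alpha(x,y)=(y,\;y e^{\alpha-x})$. Then the fixed point $(\alpha,\alpha)$ of $F_\alpha$ is locally stable, and $F_\alpha^n(x,y)\to(\alpha,\alpha)$ as $n\to\infty$ for all $(x,y)\in\mathbb{R}^2_+$.
   Context: $\mathbb{R}^2_+=(0,\infty)\times(0,\infty)$. $F_\alpha^n$ denotes the $n$-fold composition of $F_\alpha$ (the 2-dimensional Ricker map). A fixed point $p$ of a continuous map $f$ with domain $\mathcal{D}_f\subseteq\mathbb{R}^n$ is called locally stable if for every $\varepsilon>0$ there exists $\delta>0$ such that $\|x-p\|<\delta$ implies $\|f^n(x)-p\|<\varepsilon$ for all $n\in\mathbb{N}$. *)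

theory Defs
  imports "HOL-Analysis.Analysis"
begin

definition ricker :: "real \<Rightarrow> real \<times> real \<Rightarrow> real \<times> real" where
  "ricker \<alpha> = (\<lambda>(x, y). (y, y * exp (\<alpha> - x)))"

(* Stated for maps whose domain is the whole space. *)
definition locally_stable :: "('a::euclidean_space \<Rightarrow> 'a) \<Rightarrow> 'a \<Rightarrow> bool" where
  "locally_stable f p \<longleftrightarrow>
     continuous_on UNIV f \<and> f p = p \<and>
     (\<forall>\<epsilon>>0. \<exists>\<delta>>0. \<forall>x. norm (x - p) < \<delta> \<longrightarrow> (\<forall>n. norm ((f ^^ n) x - p) < \<epsilon>))"

end

theory Submission
  imports Defs
begin

text \<open>
  With \<open>x\<^sub>n\<close> the first coordinate of the \<open>n\<close>-th iterate and \<open>u\<^sub>n = ln (x\<^sub>n / \<alpha>)\<close> an orbit in the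
  open quadrant becomes a solution of \<open>u\<^sub>n\<^sub>+\<^sub>2 = u\<^sub>n\<^sub>+\<^sub>1 - g u\<^sub>n\<close> with \<open>g x = \<alpha> (e\<^sup>x - 1)\<close>, and the fixed point
  becomes \<open>0\<close>. At \<open>\<alpha> = 1\<close> the linearization \<open>u\<^sub>n\<^sub>+\<^sub>2 = u\<^sub>n\<^sub>+\<^sub>1 - u\<^sub>n\<close> is a rotation of order 6, so stability
  has to come from the nonlinear terms, and an estimate that is to see them must follow an orbit
  over a whole turn.

  Put \<open>h x = x - g x\<close>. Two steps combine to \<open>u\<^sub>n\<^sub>+\<^sub>3 = h u\<^sub>n\<^sub>+\<^sub>1 - g u\<^sub>n\<close>, and two such identities link a
  value \<open>w\<close> to the value six steps earlier. Write \<open>a, b, c, d, e, v, w\<close> for seven consecutive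
  terms, all but the last at most \<open>M\<close>. Up to an easy case, a large \<open>w\<close> has \<open>e \<le> 0\<close>, as otherwise \<open>w < v\<close>.
  Then \<open>h e \<le> 0\<close>, and
    \<open>w = h e - g d\<close>,  \<open>d = h b - g a \<ge> h b - g M\<close>.
  If \<open>b \<ge> 0\<close>, the quadratic terms \<open>h b\<close> and \<open>h e\<close> cancel, in the sense that \<open>h e \<le> h b\<close>
  (\<open>h_three_steps_later_le\<close>). As \<open>\<alpha> \<le> 1\<close>, this leaves \<open>w \<le> - g (- g M) \<le> 1 - exp (1 - e\<^sup>M)\<close>, which is
  below \<open>M\<close> by about \<open>M\<^sup>3 / 6\<close>. If \<open>b < 0\<close>, only orbits with \<open>d < 0\<close>
  matter, and these are nonpositive from \<open>b\<close> to \<open>e\<close>; such a long stay costs at most a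
  correction of fourth order in \<open>M\<close>, which the cubic gain absorbs. The result is a bound
  \<open>w \<le> peak_bound M\<close> that does not depend on \<open>\<alpha>\<close> (\<open>peak_le_bound\<close>), with
  \<open>peak_bound M < M\<close> for \<open>0 < M \<le> 1\<close> (\<open>peak_bound_less\<close>).

  Stability follows since bounds \<open>u \<le> M\<close> and \<open>u \<ge> - depth M\<close> reproduce themselves once they hold for eight
  consecutive terms (\<open>trapped\<close>). For convergence, an orbit that is finally of one sign is finally
  monotone. Any other orbit is finally at most \<open>1\<close>, and an eventual upper bound \<open>M\<close> can always be
  improved to \<open>max (peak_bound M) ((1 - \<alpha>) M)\<close> (\<open>contraction\<close>), so the infimum of the eventual upper
  bounds is \<open>0\<close>; the lower bounds follow because \<open>depth M\<close> tends to \<open>0\<close> with \<open>M\<close>.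
\<close>

section \<open>The bound on peaks and elementary inequalities\<close>

definition overshoot :: "real \<Rightarrow> real" where
  "overshoot M = exp M - 1 - M"

text \<open>
  The exponent consists of the estimate \<open>g M \<le> e\<^sup>M - 1\<close> and an allowance for orbits that
  stay nonpositive for four or more steps.
\<close>
definition peak_bound :: "real \<Rightarrow> real" where
  "peak_bound M = 1 - exp (- (exp M - 1 + (overshoot M)\<^sup>2 / 2))"

lemma one_plus_mult_exp_minus_le_one: "(1 + t) * exp (- t) \<le> (1::real)"
proof -
  have "(1 + t) * exp (- t) \<le> exp t * exp (- t)"
    by (intro mult_right_mono) auto
  then show ?thesis by (simp add: exp_minus)
qed

text \<open>
  The product \<open>(1 - q + q\<^sup>2 / 2) (1 + q + q\<^sup>2 / 2) = 1 + q\<^sup>4 / 4\<close> is at least \<open>1\<close>, and the second factor is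
  at most \<open>e\<^sup>q\<close>.
\<close>
lemma exp_minus_le_quadratic:
  assumes "0 \<le> (q::real)"
  shows "exp (- q) \<le> 1 - q + q\<^sup>2 / 2"
proof -
  have pos: "0 \<le> 1 - q + q\<^sup>2 / 2"
    using zero_le_power2[of "1 - q"] by (simp add: power2_eq_square algebra_simps)
  have "1 \<le> (1 - q + q\<^sup>2 / 2) * (1 + q + q\<^sup>2 / 2)"
  proof -
    have "(1 - q + q\<^sup>2 / 2) * (1 + q + q\<^sup>2 / 2) = 1 + (q\<^sup>2 / 2)\<^sup>2"
      by (simp add: power2_eq_square algebra_simps)
    then show ?thesis by simp
  qed
  also have "\<dots> \<le> (1 - q + q\<^sup>2 / 2) * exp q"
    using pos exp_lower_Taylor_quadratic[OF assms] by (intro mult_left_mono) auto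
  finally show ?thesis by (simp add: exp_minus field_simps)
qed

lemma concave_on_Icc_ge_min:
  fixes f :: "real \<Rightarrow> real"
  assumes "concave_on {l..r} f" "l \<le> x" "x \<le> r"
  shows "min (f l) (f r) \<le> f x"
proof -
  obtain s where s: "0 \<le> s" "s \<le> 1" "x = (1 - s) * l + s * r"
  proof (cases "l = r")
    case True
    then show ?thesis using that[of 0] assms by auto
  next
    case False
    then have "l < r" using assms by linarith
    define s where "s = (x - l) / (r - l)"
    have "s * (r - l) = x - l" using \<open>l < r\<close> by (simp add: s_def)
    then have "x = (1 - s) * l + s * r" by (simp add: algebra_simps)
    moreover have "0 \<le> s" "s \<le> 1" using \<open>l < r\<close> assms by (auto simp: s_def)
    ultimately show ?thesis using that by blast
  qed
  have "(1 - s) * f l + s * f r \<le> f ((1 - s) *\<^sub>R l + s *\<^sub>R r)"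
    using concave_onD[OF assms(1), of s l r] s(1,2) assms(2,3) by auto
  moreover have "min (f l) (f r) = (1 - s) * min (f l) (f r) + s * min (f l) (f r)"
    by (simp add: algebra_simps)
  moreover have "(1 - s) * min (f l) (f r) \<le> (1 - s) * f l" "s * min (f l) (f r) \<le> s * f r"
    using s by (auto intro!: mult_left_mono)
  ultimately show ?thesis using s(3) by simp
qed

lemma overshoot_le_square:
  assumes "0 \<le> M" "M \<le> 1"
  shows "overshoot M \<le> M\<^sup>2"
  using exp_bound[of M] assms by (simp add: overshoot_def)

lemma overshoot_nonneg: "0 \<le> overshoot M"
  using exp_ge_add_one_self[of M] unfolding overshoot_def by linarith

text \<open>
  The claim reads \<open>e\<^sup>M - 1 + (e\<^sup>M - 1 - M)\<^sup>2 / 2 < - ln (1 - M)\<close>, where the two sides first differ in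
  the cubic term. Comparing derivatives turns it into \<open>(1 - t) e\<^sup>t (e\<^sup>t - 1 - t) < t\<^sup>2\<close>.
\<close>
lemma peak_bound_less:
  assumes "0 < M" "M \<le> 1"
  shows "peak_bound M < M"
proof (cases "M = 1")
  case True
  then show ?thesis by (simp add: peak_bound_def)
next
  case False
  then have M: "M < 1" using assms by simp
  define f where "f t = - ln (1 - t) - (exp t - 1 + (exp t - 1 - t)\<^sup>2 / 2)" for t :: real
  have "f 0 < f M"
  proof (rule DERIV_pos_imp_increasing_open[OF assms(1)])
    fix t :: real assume t: "0 < t" "t < M"
    have deriv: "(f has_real_derivative (1 / (1 - t) - (exp t + (exp t - 1 - t) * (exp t - 1)))) (at t)"
      unfolding f_def using t M
      by (auto intro!: derivative_eq_intros simp: algebra_simps power2_eq_square add_divide_distrib diff_divide_distrib)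
    have "(1 - t) * (exp t + (exp t - 1 - t) * (exp t - 1)) < 1"
    proof -
      have e: "exp t - 1 - t \<le> t\<^sup>2" using overshoot_le_square[of t] t M by (simp add: overshoot_def)
      have "0 < t\<^sup>2 / 2" using t by simp
      then have e0: "0 < exp t - 1 - t" using exp_lower_Taylor_quadratic[of t] t by linarith
      have "1 - t < exp (- t)" using exp_minus_greater[of t] t by simp
      then have "(1 - t) * exp t < exp (- t) * exp t" by (intro mult_strict_right_mono) auto
      then have "(1 - t) * exp t < 1" by (simp add: exp_minus)
      then have "((1 - t) * exp t) * (exp t - 1 - t) < 1 * (exp t - 1 - t)"
        using e0 by (intro mult_strict_right_mono) auto
      then have "((1 - t) * exp t) * (exp t - 1 - t) < t\<^sup>2"
        by (rule less_le_trans) (use e in simp)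
      then show ?thesis by (simp add: algebra_simps power2_eq_square)
    qed
    then have pos: "0 < 1 / (1 - t) - (exp t + (exp t - 1 - t) * (exp t - 1))"
      using t M by (simp add: pos_less_divide_eq mult.commute)
    show "\<exists>y. (f has_real_derivative y) (at t) \<and> 0 < y" using deriv pos by blast
  next
    show "continuous_on {0..M} f"
      unfolding f_def using M by (auto intro!: continuous_intros)
  qed
  then have "exp M - 1 + (overshoot M)\<^sup>2 / 2 < - ln (1 - M)"
    by (simp add: f_def overshoot_def)
  then have "exp (ln (1 - M)) < exp (- (exp M - 1 + (overshoot M)\<^sup>2 / 2))"
    by (subst exp_less_cancel_iff) linarith
  then show ?thesis using M by (simp add: peak_bound_def)
qed

section \<open>The peak estimate for the delayed recursion\<close>

locale delayed_ricker =
  fixes \<alpha> :: real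
  assumes alpha_pos: "0 < \<alpha>" and alpha_le_1: "\<alpha> \<le> 1"
begin

text \<open>
  In logarithmic coordinates centred at the fixed point the recursion is \<open>u\<^sub>n\<^sub>+\<^sub>2 = u\<^sub>n\<^sub>+\<^sub>1 - g u\<^sub>n\<close>.
\<close>
definition g :: "real \<Rightarrow> real" where
  "g x = \<alpha> * (exp x - 1)"

text \<open>
  The Ricker map without delay in the same coordinates. At \<open>\<alpha> = 1\<close> it is \<open>- x\<^sup>2 / 2\<close> up to higher
  order terms.
\<close>
definition h :: "real \<Rightarrow> real" where
  "h x = x - g x"

text \<open>
  An orbit bounded above by \<open>M\<close> cannot fall from nonnegative values below \<open>- depth M\<close>: by
  concavity this is the minimum of \<open>h y - g x\<close> over \<open>0 \<le> y \<le> M\<close> and \<open>x \<le> M\<close>.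
\<close>
definition depth :: "real \<Rightarrow> real" where
  "depth M = g M + max 0 (- h M)"

lemma g_le_iff [simp]: "g x \<le> g y \<longleftrightarrow> x \<le> y"
  using alpha_pos by (simp add: g_def)

lemma g_0 [simp]: "g 0 = 0" and h_0 [simp]: "h 0 = 0"
  by (simp_all add: g_def h_def)

lemma g_nonpos_iff [simp]: "g x \<le> 0 \<longleftrightarrow> x \<le> 0" and g_nonneg_iff [simp]: "0 \<le> g x \<longleftrightarrow> 0 \<le> x"
  using g_le_iff[of x 0] g_le_iff[of 0 x] by (simp_all del: g_le_iff)

lemma g_ge: "\<alpha> * x \<le> g x"
proof -
  have "x \<le> exp x - 1" using exp_ge_add_one_self[of x] by linarith
  then show ?thesis unfolding g_def using alpha_pos by (intro mult_left_mono) auto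
qed

lemma g_le_exp: "0 \<le> x \<Longrightarrow> g x \<le> exp x - 1"
  using alpha_le_1 mult_right_mono[of \<alpha> 1 "exp x - 1"] by (simp add: g_def)

lemma neg_g_neg_le: "x \<le> y \<Longrightarrow> 0 \<le> y \<Longrightarrow> - g (- x) \<le> 1 - exp (- y)"
proof -
  assume "x \<le> y" "0 \<le> y"
  then have "- g (- x) \<le> - g (- y)" by simp
  also have "\<dots> = \<alpha> * (1 - exp (- y))" by (simp add: g_def algebra_simps)
  also have "\<dots> \<le> 1 - exp (- y)"
    using alpha_le_1 \<open>0 \<le> y\<close> mult_right_mono[of \<alpha> 1 "1 - exp (- y)"] by simp
  finally show ?thesis .
qed

lemma h_mono_nonpos:
  assumes "x \<le> y" "y \<le> 0"
  shows "h x \<le> h y"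
proof -
  have "1 - exp (x - y) \<le> y - x" using exp_ge_add_one_self[of "x - y"] by linarith
  then have "exp y * (1 - exp (x - y)) \<le> 1 * (y - x)"
    using assms by (intro mult_mono) auto
  then have "exp y - exp x \<le> y - x" by (simp add: algebra_simps exp_diff)
  then have "\<alpha> * (exp y - exp x) \<le> 1 * (y - x)"
    using alpha_pos alpha_le_1 assms by (intro mult_mono) auto
  then show ?thesis by (simp add: h_def g_def algebra_simps)
qed

lemma h_nonpos: "x \<le> 0 \<Longrightarrow> h x \<le> 0"
  using h_mono_nonpos[of x 0] by simp

lemma h_le: "h x \<le> (1 - \<alpha>) * x"
  using g_ge[of x] by (simp add: h_def algebra_simps)

lemma convex_on_g: "convex S \<Longrightarrow> convex_on S g"
proof -
  have "convex_on UNIV g"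
  proof (rule convex_on_realI)
    show "connected (UNIV :: real set)" by simp
    show "\<And>x. x \<in> UNIV \<Longrightarrow> (g has_real_derivative (\<alpha> * exp x)) (at x)"
      unfolding g_def by (auto intro!: derivative_eq_intros)
    show "\<And>x y. x \<in> UNIV \<Longrightarrow> y \<in> UNIV \<Longrightarrow> x \<le> y \<Longrightarrow> \<alpha> * exp x \<le> \<alpha> * exp y"
      using alpha_pos by simp
  qed
  then show "convex S \<Longrightarrow> convex_on S g" by (rule convex_on_subset) auto
qed

lemma concave_on_h: "convex S \<Longrightarrow> concave_on S h"
  unfolding h_def using convex_on_g
  by (intro concave_on_diff) (auto simp: concave_on_iff algebra_simps)

lemma h_le_max: "h x \<le> \<alpha> - 1 - ln \<alpha>"
proof -
  have "1 + (x + ln \<alpha>) \<le> exp (x + ln \<alpha>)" by (rule exp_ge_add_one_self)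
  then show ?thesis using alpha_pos by (simp add: h_def g_def exp_add algebra_simps)
qed

text \<open>
  The maximum \<open>\<alpha> - 1 - ln \<alpha>\<close> of \<open>h\<close> does not exceed the point \<open>- ln \<alpha>\<close> where it is attained,
  and \<open>h\<close> increases from \<open>h 0 = 0\<close> up to that point.
\<close>
lemma h_nonneg_of_le_max:
  assumes "0 \<le> k" "k \<le> \<alpha> - 1 - ln \<alpha>"
  shows "0 \<le> h k"
proof -
  have "exp k \<le> exp (- ln \<alpha>)" using assms alpha_le_1 by simp
  then have ek: "\<alpha> * exp k \<le> 1" using alpha_pos by (simp add: exp_minus field_simps)
  have "1 - exp (- k) \<le> k" using exp_ge_add_one_self[of "- k"] by linarith
  then have "(\<alpha> * exp k) * (1 - exp (- k)) \<le> 1 * k"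
    using ek assms alpha_pos by (intro mult_mono) auto
  then show ?thesis by (simp add: h_def g_def algebra_simps flip: exp_add)
qed

text \<open>
  Near \<open>0\<close> and for \<open>\<alpha> = 1\<close> three steps are nearly a half turn: if \<open>c\<close> follows \<open>b\<close>, then \<open>e = h c - g b\<close>
  comes three steps after \<open>b\<close>, and it is close to \<open>- b\<close>. The lemma says that the even parts of \<open>h\<close> cancel
  to the right side. With \<open>k = h c\<close> fixed, the difference of the two sides is a function
  of \<open>b\<close>. It is nondecreasing on the range \<open>g b \<ge> k\<close>, that is, where \<open>e \<le> 0\<close>, so it suffices to look at the
  left end of this range within \<open>b \<ge> 0\<close>.
\<close>
lemma h_three_steps_later_le:
  assumes b: "0 \<le> b" and e: "h c - g b \<le> 0"
  shows "h (h c - g b) \<le> h b"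
proof -
  define k where "k = h c"
  define \<phi> where "\<phi> x = x - k - \<alpha> * (1 - exp (k - g x))" for x
  have k_max: "k \<le> \<alpha> - 1 - ln \<alpha>" unfolding k_def by (rule h_le_max)
  obtain b0 where b0: "b0 \<le> b" "k \<le> g b0" "0 \<le> \<phi> b0"
  proof (cases "0 \<le> k")
    case True
    \<comment> \<open>This is the point with \<open>g b0 = k\<close>, where \<open>e = 0\<close>.\<close>
    define b0 where "b0 = ln (1 + k / \<alpha>)"
    have "0 < 1 + k / \<alpha>" using True alpha_pos by (simp add: add_pos_nonneg)
    then have gb0: "g b0 = k" using alpha_pos by (simp add: g_def b0_def)
    have "g k \<le> k" using h_nonneg_of_le_max[OF True k_max] by (simp add: h_def)
    then have "k \<le> b0" using gb0 g_le_iff[of k b0] by simp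
    moreover have "b0 \<le> b" using e gb0 g_le_iff[of b0 b] by (simp add: k_def)
    ultimately show ?thesis using that[of b0] gb0 by (simp add: \<phi>_def)
  next
    case False
    then have "h k \<le> 0" using h_nonpos by simp
    then have "0 \<le> \<phi> 0" by (simp add: \<phi>_def h_def g_def algebra_simps)
    then show ?thesis using that[of 0] b False by simp
  qed
  have "\<phi> b0 \<le> \<phi> b"
  proof (rule DERIV_nonneg_imp_nondecreasing[OF b0(1)])
    fix x assume x: "b0 \<le> x" "x \<le> b"
    define t where "t = g x - k"
    have "g b0 \<le> g x" using x(1) by simp
    then have t: "0 \<le> t" using b0(2) unfolding t_def by linarith
    have "(\<phi> has_real_derivative (1 - \<alpha> * (exp (- t) * (\<alpha> * exp x)))) (at x)"
      unfolding \<phi>_def t_def g_def by (auto intro!: derivative_eq_intros simp: algebra_simps)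
    moreover have "\<alpha> * (exp (- t) * (\<alpha> * exp x)) \<le> 1"
    proof -
      \<comment> \<open>The bound on \<open>k\<close> gives \<open>\<alpha> (\<alpha> + k) \<le> 2 \<alpha>\<^sup>2 - 2 \<alpha> + 1 \<le> 1\<close>.\<close>
      have "- ln \<alpha> \<le> 1 / \<alpha> - 1"
        using ln_le_minus_one[of "1 / \<alpha>"] alpha_pos by (simp add: ln_div)
      then have "\<alpha> * exp x \<le> \<alpha> + (\<alpha> - 1 + (1 / \<alpha> - 1)) + t"
        using k_max by (simp add: t_def g_def algebra_simps)
      then have "\<alpha> * (\<alpha> * exp x) \<le> \<alpha> * (\<alpha> + (\<alpha> - 1 + (1 / \<alpha> - 1)) + t)"
        using alpha_pos by (intro mult_left_mono) auto
      also have "\<dots> = 1 - 2 * (\<alpha> * (1 - \<alpha>)) + \<alpha> * t"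
        using alpha_pos by (simp add: field_simps)
      also have "\<dots> \<le> 1 + t"
        using alpha_pos alpha_le_1 t mult_right_mono[of \<alpha> 1 t]
          mult_nonneg_nonneg[of \<alpha> "1 - \<alpha>"] by linarith
      finally have "(\<alpha> * (\<alpha> * exp x)) * exp (- t) \<le> (1 + t) * exp (- t)"
        by (intro mult_right_mono) auto
      also have "\<dots> \<le> 1" by (rule one_plus_mult_exp_minus_le_one)
      finally show ?thesis by (simp only: mult_ac)
    qed
    ultimately show "\<exists>y. (\<phi> has_real_derivative y) (at x) \<and> 0 \<le> y"
      by (intro exI conjI) auto
  qed
  then have "0 \<le> \<phi> b" using b0(3) by linarith
  then show ?thesis by (simp add: \<phi>_def k_def h_def g_def algebra_simps)
qed

text \<open>
  In a window \<open>a, b, c, d, e, v, w\<close> one has \<open>w = h e - g d\<close>, so when \<open>e \<le> 0\<close> a lower bound on \<open>d\<close>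
  suffices. The two lemmas on long runs below supply it when \<open>b < 0\<close>.
\<close>
lemma peak_le_bound_if_ge:
  assumes "- (exp M - 1 + (overshoot M)\<^sup>2 / 2) \<le> d" "e \<le> 0" "0 \<le> M"
  shows "h e - g d \<le> peak_bound M"
proof -
  define y where "y = exp M - 1 + (overshoot M)\<^sup>2 / 2"
  have "0 \<le> y" using assms(3) by (simp add: y_def)
  have "h e - g d \<le> - g (- y)"
    using h_nonpos[OF assms(2)] g_le_iff[of "- y" d] assms(1) unfolding y_def by linarith
  also have "\<dots> \<le> 1 - exp (- y)" using \<open>0 \<le> y\<close> by (intro neg_g_neg_le) auto
  finally show ?thesis by (simp add: peak_bound_def y_def)
qed

lemma neg_h_le_overshoot: "0 \<le> M \<Longrightarrow> - h M \<le> overshoot M"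
  using g_le_exp[of M] by (simp add: h_def overshoot_def)

text \<open>
  Here \<open>a\<close> is the last nonnegative term before \<open>b\<close>, and \<open>b \<ge> a - g M\<close> because the term before
  \<open>a\<close> is at most \<open>M\<close>. The resulting lower bound \<open>h (a - g M) - g a\<close> for \<open>d = h b - g a\<close> is concave
  in \<open>a\<close>, so only the extreme values of \<open>a\<close> matter; as \<open>b \<le> 0\<close> forces \<open>a \<le> g M\<close>, these are \<open>0\<close> and
  \<open>min M (g M)\<close>. The loss at \<open>a = M < g M\<close> is what the quadratic term in the peak bound pays for.
\<close>
lemma long_run_bound_at_entry:
  assumes a: "0 \<le> a" "a \<le> M" and b: "a - g M \<le> b" "b \<le> 0"
  shows "- (exp M - 1 + (overshoot M)\<^sup>2 / 2) \<le> h b - g a"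
proof -
  have M: "0 \<le> M" using a by simp
  define r where "r = min M (g M)"
  define f where "f x = h (x - g M) - g x" for x
  have f_alt: "f x = (x - g M) + (\<alpha> - (\<alpha> * exp (- g M) + \<alpha>) * exp x) + \<alpha>" for x
    by (simp add: f_def h_def g_def algebra_simps flip: exp_add)
  have conc: "concave_on {0..r} f"
  proof (rule f''_le0_imp_concave[where f' = "\<lambda>x. 1 - (\<alpha> * exp (- g M) + \<alpha>) * exp x"
        and f'' = "\<lambda>x. - (\<alpha> * exp (- g M) + \<alpha>) * exp x"])
    show "(f has_real_derivative 1 - (\<alpha> * exp (- g M) + \<alpha>) * exp x) (at x)" for x
      unfolding f_alt[abs_def] by (auto intro!: derivative_eq_intros)
    show "((\<lambda>x. 1 - (\<alpha> * exp (- g M) + \<alpha>) * exp x) has_real_derivative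
        - (\<alpha> * exp (- g M) + \<alpha>) * exp x) (at x)" for x
      by (auto intro!: derivative_eq_intros simp: algebra_simps)
    have "0 \<le> \<alpha> * exp (- g M) + \<alpha>" using alpha_pos by (simp add: add_nonneg_nonneg)
    then show "- (\<alpha> * exp (- g M) + \<alpha>) * exp x \<le> 0" for x
      by (intro mult_nonpos_nonneg) auto
  qed auto
  have gM: "g M \<le> exp M - 1" using M by (rule g_le_exp)
  have "- (exp M - 1) \<le> f 0"
  proof -
    have "- g M \<le> h (- g M)" using M by (simp add: h_def)
    then show ?thesis using gM by (simp add: f_def)
  qed
  moreover have "- (exp M - 1 + (overshoot M)\<^sup>2 / 2) \<le> f r"
  proof (cases "g M \<le> M")
    case True
    then have "f r = - g (g M)" by (simp add: f_def r_def)
    moreover have "g (g M) \<le> g M" using True by simp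
    ultimately show ?thesis using gM zero_le_power2[of "overshoot M"] by linarith
  next
    case False
    define q where "q = g M - M"
    have q: "0 \<le> q" "q \<le> exp M - 1" "q \<le> overshoot M"
      using False gM M neg_h_le_overshoot[OF M] by (auto simp: q_def h_def)
    have q2: "q\<^sup>2 \<le> (overshoot M)\<^sup>2" using q by (intro power_mono) auto
    have "exp (- q) \<le> 1 - q + q\<^sup>2 / 2" using q(1) by (rule exp_minus_le_quadratic)
    then have "\<alpha> * exp (- q) \<le> \<alpha> * (1 - q + q\<^sup>2 / 2)" using alpha_pos by simp
    then have "q - \<alpha> * (1 - exp (- q)) \<le> (1 - \<alpha>) * q + \<alpha> * (q\<^sup>2 / 2)"
      by (simp add: algebra_simps)
    also have "\<dots> \<le> (1 - \<alpha>) * (exp M - 1) + 1 * ((overshoot M)\<^sup>2 / 2)"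
      using q q2 alpha_pos alpha_le_1 by (intro add_mono mult_mono) auto
    finally have "q - \<alpha> * (1 - exp (- q)) + g M \<le> exp M - 1 + (overshoot M)\<^sup>2 / 2"
      by (simp add: g_def algebra_simps)
    moreover have "f r = - q + \<alpha> * (1 - exp (- q)) - g M"
      using False by (simp add: f_def r_def h_def g_def[of "M - g M"] q_def algebra_simps)
    ultimately show ?thesis by linarith
  qed
  moreover have "min (f 0) (f r) \<le> f a"
    using conc a b by (intro concave_on_Icc_ge_min) (auto simp: r_def)
  then have "f 0 \<le> f a \<or> f r \<le> f a" by (simp add: min_le_iff_disj)
  moreover have "f a \<le> h b - g a" using h_mono_nonpos[OF b] by (simp add: f_def)
  ultimately show ?thesis using zero_le_power2[of "overshoot M"] by linarith
qed

text \<open>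
  When \<open>a\<close> is nonpositive too, \<open>d = h b - g a \<ge> h b \<ge> h (- depth M)\<close>, and in this step upwards the
  orbit regains the excess of \<open>depth M\<close> over \<open>e\<^sup>M - 1\<close>, up to the quadratic term in the peak bound.
\<close>
lemma long_run_bound_inside:
  assumes M: "0 \<le> M" "M \<le> 1" and a: "a \<le> 0" and b: "- depth M \<le> b" "b \<le> 0"
  shows "- (exp M - 1 + (overshoot M)\<^sup>2 / 2) \<le> h b - g a"
proof -
  define L where "L = depth M"
  have "L - \<alpha> * (1 - exp (- L)) \<le> exp M - 1 + (overshoot M)\<^sup>2 / 2"
  proof (cases "0 \<le> h M")
    case True
    then have L: "L = g M" by (simp add: L_def depth_def)
    then have "0 \<le> \<alpha> * (1 - exp (- L))" using alpha_pos M by simp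
    then show ?thesis using g_le_exp[OF M(1)] zero_le_power2[of "overshoot M"] unfolding L by linarith
  next
    case False
    define w where "w = overshoot M"
    have L: "L = 2 * g M - M" using False by (simp add: L_def depth_def h_def)
    have "M \<le> L" using False by (simp add: L h_def)
    then have "exp (- L) \<le> exp (- M)" by simp
    then have "L - \<alpha> * (1 - exp (- L)) \<le> - M + \<alpha> * (2 * (exp M - 1) - (1 - exp (- M)))"
      using alpha_pos by (simp add: L g_def algebra_simps)
    also have "\<dots> \<le> - M + 1 * (2 * (exp M - 1) - (1 - exp (- M)))"
    proof -
      define p where "p = exp M - 1"
      have "1 - exp (- M) \<le> M" using exp_ge_add_one_self[of "- M"] by linarith
      moreover have "M \<le> p" using exp_ge_add_one_self[of M] unfolding p_def by linarith
      ultimately have "0 \<le> 2 * p - (1 - exp (- M))" using M(1) by linarith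
      then show ?thesis using alpha_le_1 unfolding p_def
        by (intro add_left_mono mult_right_mono)
    qed
    also have "\<dots> = exp M - 1 + w - (1 - exp (- M))" by (simp add: w_def overshoot_def)
    also have "\<dots> \<le> exp M - 1 + w\<^sup>2 / 2"
    proof -
      have "w \<le> M" 
        using overshoot_le_square[OF M] M mult_left_mono[of M 1 M] by (simp add: w_def power2_eq_square)
      have "exp (- w) \<le> 1 - w + w\<^sup>2 / 2"
        unfolding w_def by (intro exp_minus_le_quadratic overshoot_nonneg)
      moreover have "exp (- M) \<le> exp (- w)" using \<open>w \<le> M\<close> by simp
      ultimately show ?thesis by linarith
    qed
    finally show ?thesis by (simp add: w_def)
  qed
  moreover have "- L + \<alpha> * (1 - exp (- L)) = h (- L)" by (simp add: h_def g_def algebra_simps)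
  moreover have "h (- L) \<le> h b" using b by (intro h_mono_nonpos) (auto simp: L_def)
  moreover have "g a \<le> 0" using a by simp
  ultimately show ?thesis by linarith
qed

text \<open>
  The proof distinguishes: no long nonpositive stretch before the peak, one that
  begins at \<open>b\<close>, and one that begins earlier. Only the second needs the term \<open>z\<close> before \<open>a\<close>, for \<open>b \<ge> a - g M\<close>.
\<close>
lemma peak_le_bound:
  assumes M: "0 \<le> M" "M \<le> 1" and z: "z \<le> M" and a: "a \<le> M"
    and b: "b = a - g z" "- depth M \<le> b"
    and c: "c = b - g a" and d: "d = c - g b" and e: "e = d - g c" "e \<le> 0"
  shows "e - g d - g e \<le> peak_bound M"
proof -
  have dh: "d = h b - g a" using c d by (simp add: h_def)
  have eh: "e = h c - g b" using d e by (simp add: h_def)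
  have gM: "g M \<le> exp M - 1" using M by (intro g_le_exp)
  have ga: "g a \<le> g M" using a by simp
  have "h e - g d \<le> peak_bound M"
  proof (cases "0 \<le> b")
    case True
    have "h e \<le> h b" unfolding eh using True e(2) eh by (intro h_three_steps_later_le) auto
    then have "h e - g M \<le> d" using dh ga by linarith
    then have "g (h e - g M) \<le> g d" by simp
    moreover have "h (h e - g M) \<le> h (- g M)"
      using h_nonpos[OF e(2)] M by (intro h_mono_nonpos) auto
    moreover have "h (h e - g M) = h e - g M - g (h e - g M)" "h (- g M) = - g M - g (- g M)"
      by (simp_all add: h_def)
    ultimately have "h e - g d \<le> - g (- g M)" by linarith
    also have "\<dots> \<le> 1 - exp (- (exp M - 1))" using gM M by (intro neg_g_neg_le) auto
    also have "\<dots> \<le> peak_bound M" by (simp add: peak_bound_def)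
    finally show ?thesis .
  next
    case b0: False
    have "- (exp M - 1 + (overshoot M)\<^sup>2 / 2) \<le> d"
    proof (cases "0 \<le> a")
      case True
      have "g z \<le> g M" using z by simp
      then show ?thesis unfolding dh using True a b b0 by (intro long_run_bound_at_entry) auto
    next
      case False
      then show ?thesis unfolding dh using M b b0 by (intro long_run_bound_inside) auto
    qed
    then show ?thesis using e M by (intro peak_le_bound_if_ge) auto
  qed
  then show ?thesis by (simp add: h_def)
qed

lemma g_le_depth: "0 \<le> M \<Longrightarrow> g M \<le> depth M"
  by (simp add: depth_def)

lemma depth_le:
  assumes "0 \<le> M" "M \<le> 1"
  shows "depth M \<le> 4 * M"
proof -
  have "g M \<le> 2 * M"
    using g_le_exp[OF assms(1)] overshoot_le_square[OF assms] mult_left_mono[of M 1 M] assms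
    by (simp add: overshoot_def power2_eq_square)
  moreover have "depth M \<le> 2 * g M" using assms(1) by (auto simp: depth_def h_def max_def)
  ultimately show ?thesis by linarith
qed

lemma neg_depth_le:
  assumes "x \<le> M" "0 \<le> y" "y \<le> M"
  shows "- depth M \<le> h y - g x"
proof -
  have "min (h 0) (h M) \<le> h y"
    using assms by (intro concave_on_Icc_ge_min concave_on_h) auto
  moreover have "min 0 (h M) = - max 0 (- h M)" by (simp add: min_def max_def)
  moreover have "g x \<le> g M" using assms by simp
  ultimately show ?thesis unfolding depth_def h_0 by linarith
qed

end

section \<open>Invariant bounds and convergence of orbits\<close>

locale ricker_orbit = delayed_ricker +
  fixes u :: "nat \<Rightarrow> real"
  assumes step: "u (Suc (Suc n)) = u (Suc n) - g (u n)"
begin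

lemma two_step: "u (n + 3) = h (u (n + 1)) - g (u n)"
  using step[of n] step[of "Suc n"] by (simp add: h_def eval_nat_numeral)

lemma nonincreasing: "0 \<le> u n \<Longrightarrow> u (n + 2) \<le> u (n + 1)"
  and nondecreasing: "u n \<le> 0 \<Longrightarrow> u (n + 1) \<le> u (n + 2)"
  using step[of n] g_nonneg_iff[of "u n"] g_nonpos_iff[of "u n"] by simp_all

lemma window_peak_le:
  assumes M: "0 \<le> M" "M \<le> 1" and "u n \<le> M" "u (n + 1) \<le> M"
    and "- depth M \<le> u (n + 2)" and "u (n + 5) \<le> 0"
  shows "u (n + 7) \<le> peak_bound M"
proof -
  have s: "u (n + k + 2) = u (n + k + 1) - g (u (n + k))" for k
    using step[of "n + k"] by simp
  have "u (n + 5) - g (u (n + 4)) - g (u (n + 5)) \<le> peak_bound M"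
    using assms s[of 0] s[of 1] s[of 2] s[of 3]
    by (intro peak_le_bound[where z = "u n" and a = "u (n + 1)" and b = "u (n + 2)" and c = "u (n + 3)"])
       (auto simp: eval_nat_numeral)
  then show ?thesis using s[of 4] s[of 5] by (simp add: eval_nat_numeral)
qed

lemma lower_bound_step:
  assumes "u n \<le> M" "u (n + 1) \<le> M" "- depth M \<le> u (n + 2)"
  shows "- depth M \<le> u (n + 3)"
proof (cases "0 \<le> u (n + 1)")
  case True
  then show ?thesis unfolding two_step using assms by (intro neg_depth_le) auto
next
  case False
  then show ?thesis using nondecreasing[of "n + 1"] assms(3) by (simp add: eval_nat_numeral)
qed

text \<open>
  A term is either at most its predecessor or, two steps after a nonpositive term, subject to the
  peak estimate; likewise for lower bounds. Eight terms contain all windows that are needed.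
\<close>
lemma trapped:
  assumes M: "0 < M" "M \<le> 1"
    and init: "\<And>k. k < 8 \<Longrightarrow> - depth M \<le> u k \<and> u k \<le> M"
  shows "- depth M \<le> u n \<and> u n \<le> M"
proof (induction n rule: less_induct)
  case (less n)
  show ?case
  proof (cases "n < 8")
    case True
    then show ?thesis by (rule init)
  next
    case False
    then obtain m where n: "n = m + 8" by (metis add.commute le_Suc_ex not_less)
    have IH: "- depth M \<le> u (m + k)" "u (m + k) \<le> M" if "k < 8" for k
      using less[of "m + k"] that n by auto
    have "- depth M \<le> u (m + 5 + 3)"
      using IH[of 5] IH[of 6] IH[of 7] by (intro lower_bound_step) (auto simp: eval_nat_numeral)
    moreover have "u (m + 8) \<le> M"
    proof (cases "0 \<le> u (m + 6)")
      case True
      then show ?thesis using nonincreasing[of "m + 6"] IH[of 7] by (simp add: eval_nat_numeral)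
    next
      case False
      then have "u (m + 1 + 7) \<le> peak_bound M"
        using M IH[of 1] IH[of 2] IH[of 3] by (intro window_peak_le) (auto simp: eval_nat_numeral)
      then show ?thesis using peak_bound_less[OF M] by (simp add: eval_nat_numeral)
    qed
    ultimately show ?thesis by (simp add: n eval_nat_numeral)
  qed
qed

text \<open>
  A term two steps after a nonpositive one is a possible peak. Otherwise the orbit is decreasing there,
  and either its predecessor is such a possible peak, or two successive decreases give
  \<open>u\<^sub>n \<le> h u\<^sub>n\<^sub>-\<^sub>2 \<le> (1 - \<alpha>) u\<^sub>n\<^sub>-\<^sub>2\<close>.
\<close>
lemma contraction:
  assumes M: "0 \<le> M" "M \<le> 1"
    and bounds: "\<And>n. N \<le> n \<Longrightarrow> - depth M \<le> u n \<and> u n \<le> M"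
    and n: "N + 8 \<le> n"
  shows "u n \<le> max (peak_bound M) ((1 - \<alpha>) * M)"
proof -
  obtain m where m: "n = m + 8" "N \<le> m"
    using n by (metis add.commute add_le_cancel_left le_Suc_ex le_add2 le_trans nat_add_left_cancel_le)
  have B: "- depth M \<le> u (m + k)" "u (m + k) \<le> M" for k
    using bounds[of "m + k"] m(2) by auto
  consider "u (m + 6) \<le> 0" | "0 \<le> u (m + 6)" "u (m + 5) \<le> 0" | "0 \<le> u (m + 6)" "0 \<le> u (m + 5)"
    by linarith
  then show ?thesis
  proof cases
    case 1
    then have "u (m + 1 + 7) \<le> peak_bound M"
      using M B[of 1] B[of 2] B[of 3] by (intro window_peak_le) (auto simp: eval_nat_numeral)
    then show ?thesis by (simp add: m eval_nat_numeral)
  next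
    case 2
    then have "u (m + 7) \<le> peak_bound M"
      using M B[of 0] B[of 1] B[of 2] by (intro window_peak_le) auto
    moreover have "u (m + 8) \<le> u (m + 7)"
      using nonincreasing[of "m + 6"] 2 by (simp add: eval_nat_numeral)
    ultimately show ?thesis by (simp add: m)
  next
    case 3
    have "u (m + 7) \<le> u (m + 6)" using nonincreasing[of "m + 5"] 3 by (simp add: eval_nat_numeral)
    moreover have "u (m + 8) = u (m + 7) - g (u (m + 6))"
      using step[of "m + 6"] by (simp add: eval_nat_numeral)
    ultimately have "u (m + 8) \<le> h (u (m + 6))" by (simp add: h_def)
    also have "\<dots> \<le> (1 - \<alpha>) * u (m + 6)" by (rule h_le)
    also have "\<dots> \<le> (1 - \<alpha>) * M" using B[of 6] alpha_le_1 by (intro mult_left_mono) auto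
    finally show ?thesis by (simp add: m)
  qed
qed

lemma limit_eq_0:
  assumes "u \<longlonglongrightarrow> l"
  shows "l = 0"
proof -
  have "(\<lambda>n. u (Suc n) - g (u n)) \<longlonglongrightarrow> l - g l"
    unfolding g_def using assms LIMSEQ_Suc[OF assms] by (intro tendsto_intros)
  moreover have "(\<lambda>n. u (Suc n) - g (u n)) \<longlonglongrightarrow> l"
    using LIMSEQ_Suc[OF LIMSEQ_Suc[OF assms]] by (simp add: step)
  ultimately have "g l = 0" using LIMSEQ_unique by fastforce
  then show ?thesis using alpha_pos by (simp add: g_def)
qed

lemma tendsto_0_if_eventually_one_sign:
  assumes "(\<forall>n\<ge>N. u n \<le> 0) \<or> (\<forall>n\<ge>N. 0 \<le> u n)"
  shows "u \<longlonglongrightarrow> 0"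
proof -
  define v where "v n = u (n + Suc N)" for n
  have "convergent v"
    using assms
  proof
    assume neg: "\<forall>n\<ge>N. u n \<le> 0"
    have "incseq v"
      using neg nondecreasing by (intro incseq_SucI) (simp add: v_def)
    moreover have "\<forall>n. v n \<le> 0" using neg by (simp add: v_def)
    ultimately show ?thesis by (metis convergent_def incseq_convergent)
  next
    assume pos: "\<forall>n\<ge>N. 0 \<le> u n"
    have "decseq v"
      using pos nonincreasing by (intro decseq_SucI) (simp add: v_def)
    moreover have "\<forall>n. 0 \<le> v n" using pos by (simp add: v_def)
    ultimately show ?thesis by (metis convergent_def decseq_convergent)
  qed
  then obtain l where "v \<longlonglongrightarrow> l" by (auto simp: convergent_def)
  then have "u \<longlonglongrightarrow> l" unfolding v_def by (rule LIMSEQ_offset)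
  then show ?thesis using limit_eq_0 by blast
qed

text \<open>
  Two steps after a nonpositive term the bound is \<open>u\<^sub>n\<^sub>+\<^sub>3 \<le> - g u\<^sub>n \<le> \<alpha>\<close>, and all other terms are at most
  their predecessors.
\<close>
lemma eventually_le_one:
  assumes "\<And>N. \<exists>n\<ge>N. u n \<le> 0"
  shows "\<exists>N. \<forall>n\<ge>N. u n \<le> 1"
proof -
  have after_nonpos: "u (n + 3) \<le> 1" if "u (n + 1) \<le> 0" for n
  proof -
    have "- g (u n) \<le> \<alpha>" using alpha_pos by (simp add: g_def algebra_simps)
    then show ?thesis using two_step[of n] h_nonpos[OF that] alpha_le_1 by linarith
  qed
  obtain k where "1 \<le> k" "u k \<le> 0" using assms by blast
  then obtain m where m: "u (m + 1) \<le> 0" by (metis add.commute le_Suc_ex)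
  have "u n \<le> 1" if "m + 3 \<le> n" for n
    using that
  proof (induction n rule: dec_induct)
    case base
    then show ?case using m by (rule after_nonpos)
  next
    case (step n)
    then obtain i where i: "n = i + 2" by (metis add.commute add_leD2 le_Suc_ex numeral_3_eq_3 numeral_2_eq_2 Suc_leD add_Suc_right)
    show ?case
    proof (cases "u (i + 1) \<le> 0")
      case True
      then show ?thesis using after_nonpos[of i] i by (simp add: eval_nat_numeral)
    next
      case False
      then show ?thesis using nonincreasing[of "i + 1"] step i by (simp add: eval_nat_numeral)
    qed
  qed
  then show ?thesis by blast
qed

text \<open>
  A single positive term starts the induction on the lower bound; later terms keep it
  by \<open>lower_bound_step\<close>.
\<close>
lemma eventually_ge_neg_depth:
  assumes pos: "\<And>N. \<exists>n\<ge>N. 0 < u n" and M: "\<And>n. N \<le> n \<Longrightarrow> u n \<le> M"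
  shows "\<exists>K\<ge>N. \<forall>n\<ge>K. - depth M \<le> u n \<and> u n \<le> M"
proof -
  obtain k where "Suc N \<le> k" "0 < u k" using pos by blast
  then obtain m where m: "N \<le> m" "0 < u (m + 1)"
    by (metis Suc_eq_plus1 Suc_le_D Suc_le_mono)
  have "- depth M \<le> u n" if "m + 3 \<le> n" for n
    using that
  proof (induction n rule: dec_induct)
    case base
    show ?case unfolding two_step using m M by (intro neg_depth_le) auto
  next
    case (step n)
    then obtain i where i: "n = m + 1 + i + 2" by (metis add.assoc add.commute le_Suc_ex numeral_Bit1 numeral_One one_add_one)
    then show ?case using lower_bound_step[of "m + 1 + i" M] step m M by (simp add: eval_nat_numeral)
  qed
  then show ?thesis using m M by (intro exI[of _ "m + 3"]) auto
qed

text \<open>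
  If the infimum \<open>m\<close> of the eventual upper bounds in \<open>[0, 1]\<close> were positive, then by continuity the
  contraction would send a bound close to \<open>m\<close> to a bound below \<open>m\<close>.
\<close>
lemma eventually_le_if_oscillating:
  assumes pos: "\<And>N. \<exists>n\<ge>N. 0 < u n" and neg: "\<And>N. \<exists>n\<ge>N. u n \<le> 0" and \<epsilon>: "0 < \<epsilon>"
  shows "\<exists>M N. 0 \<le> M \<and> M \<le> 1 \<and> M < \<epsilon> \<and> (\<forall>n\<ge>N. u n \<le> M)"
proof -
  define S where "S = {M. 0 \<le> M \<and> M \<le> 1 \<and> (\<exists>N. \<forall>n\<ge>N. u n \<le> M)}"
  define \<theta> where "\<theta> M = max (peak_bound M) ((1 - \<alpha>) * M)" for M
  have "1 \<in> S" using eventually_le_one[OF neg] by (simp add: S_def)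
  moreover have "bdd_below S" by (rule bdd_belowI[of _ 0]) (simp add: S_def)
  ultimately have S: "1 \<in> S" "bdd_below S" .
  define m where "m = Inf S"
  have "S \<noteq> {}" using S(1) by blast
  then have "0 \<le> m" unfolding m_def by (rule cInf_greatest) (simp add: S_def)
  moreover have "m \<le> 1" unfolding m_def using S by (rule cInf_lower)
  ultimately have m: "0 \<le> m" "m \<le> 1" .
  have "m = 0"
  proof (rule ccontr)
    assume "m \<noteq> 0"
    then have "0 < m" using m by simp
    then have "\<theta> m < m"
      using peak_bound_less[OF _ m(2)] alpha_pos by (simp add: \<theta>_def algebra_simps)
    moreover have "isCont \<theta> m"
      unfolding \<theta>_def peak_bound_def overshoot_def by (intro continuous_intros) simp_all
    ultimately have "\<forall>\<^sub>F x in at m. \<theta> x < m"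
      by (intro order_tendstoD(2)[of \<theta> "\<theta> m"]) (auto simp: isCont_def)
    then have "\<forall>\<^sub>F x in nhds m. \<theta> x < m"
      using \<open>\<theta> m < m\<close> by (simp add: eventually_nhds_conv_at)
    then obtain \<delta> where \<delta>: "0 < \<delta>" "\<And>x. dist x m < \<delta> \<Longrightarrow> \<theta> x < m"
      by (auto simp: eventually_nhds_metric)
    obtain s where s: "s \<in> S" "s < m + \<delta>"
      using cInf_lessD[of S "m + \<delta>"] S \<delta>(1) by (auto simp: m_def)
    have "m \<le> s" unfolding m_def using S s by (intro cInf_lower)
    then have ts: "\<theta> s < m" using s by (intro \<delta>(2)) (simp add: dist_real_def)
    obtain N where "0 \<le> s" "s \<le> 1" "\<And>n. N \<le> n \<Longrightarrow> u n \<le> s" using s(1) by (auto simp: S_def)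
    moreover from this obtain K where "\<And>n. K \<le> n \<Longrightarrow> - depth s \<le> u n \<and> u n \<le> s"
      using eventually_ge_neg_depth[OF pos, of N s] by blast
    ultimately have "\<forall>n\<ge>K + 8. u n \<le> \<theta> s" unfolding \<theta>_def using contraction by blast
    moreover have "0 \<le> \<theta> s" using \<open>0 \<le> s\<close> alpha_le_1 by (simp add: \<theta>_def le_max_iff_disj)
    ultimately have "\<theta> s \<in> S" using ts m by (auto simp: S_def)
    then have "m \<le> \<theta> s" unfolding m_def using S by (intro cInf_lower)
    then show False using ts by simp
  qed
  then obtain s where "s \<in> S" "s < \<epsilon>" using cInf_lessD[of S \<epsilon>] S \<epsilon> by (auto simp: m_def)
  then show ?thesis by (auto simp: S_def)
qed

lemma tendsto_0: "u \<longlonglongrightarrow> 0"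
proof (cases "(\<exists>N. \<forall>n\<ge>N. u n \<le> 0) \<or> (\<exists>N. \<forall>n\<ge>N. 0 \<le> u n)")
  case True
  then show ?thesis using tendsto_0_if_eventually_one_sign by blast
next
  case False
  then have pos: "\<exists>n\<ge>N. 0 < u n" and neg: "\<exists>n\<ge>N. u n \<le> 0" for N
    by (meson not_le order_less_imp_le)+
  show ?thesis
  proof (rule LIMSEQ_I)
    fix \<epsilon> :: real assume "0 < \<epsilon>"
    then obtain M N where M: "0 \<le> M" "M \<le> 1" "M < \<epsilon> / 4" "\<And>n. N \<le> n \<Longrightarrow> u n \<le> M"
      using eventually_le_if_oscillating[OF pos neg, of "\<epsilon> / 4"] by auto
    then obtain K where "\<And>n. K \<le> n \<Longrightarrow> - depth M \<le> u n \<and> u n \<le> M"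
      using eventually_ge_neg_depth[OF pos, of N M] by blast
    then have "\<forall>n\<ge>K. norm (u n - 0) < \<epsilon>"
      using depth_le[OF M(1,2)] M(1,3) by (fastforce simp: abs_less_iff)
    then show "\<exists>K. \<forall>n\<ge>K. norm (u n - 0) < \<epsilon>" by blast
  qed
qed

end

section \<open>Back to the planar map\<close>

lemma ricker_iterate:
  "(ricker \<alpha> ^^ Suc n) z = (snd ((ricker \<alpha> ^^ n) z),
     snd ((ricker \<alpha> ^^ n) z) * exp (\<alpha> - fst ((ricker \<alpha> ^^ n) z)))"
  by (simp add: ricker_def split_beta)

definition log_orbit :: "real \<Rightarrow> real \<times> real \<Rightarrow> nat \<Rightarrow> real" where
  "log_orbit \<alpha> z n = ln (fst ((ricker \<alpha> ^^ n) z) / \<alpha>)"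

lemma ricker_iterate_pos:
  assumes "0 < fst z" "0 < snd z"
  shows "0 < fst ((ricker \<alpha> ^^ n) z) \<and> 0 < snd ((ricker \<alpha> ^^ n) z)"
  using assms by (induction n) (auto simp: ricker_iterate simp del: funpow.simps(2))

lemma ricker_iterate_eq_log_orbit:
  assumes "0 < \<alpha>" "0 < fst z" "0 < snd z"
  shows "(ricker \<alpha> ^^ n) z = (\<alpha> * exp (log_orbit \<alpha> z n), \<alpha> * exp (log_orbit \<alpha> z (Suc n)))"
  using assms ricker_iterate_pos[OF assms(2,3), of n \<alpha>]
  by (simp add: log_orbit_def ricker_iterate prod_eq_iff del: funpow.simps(2))

lemma ricker_orbit_log_orbit:
  assumes \<alpha>: "0 < \<alpha>" "\<alpha> \<le> 1" and z: "0 < fst z" "0 < snd z"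
  shows "ricker_orbit \<alpha> (log_orbit \<alpha> z)"
proof -
  interpret delayed_ricker \<alpha> using \<alpha> by unfold_locales
  show ?thesis
  proof unfold_locales
    fix n
    define p where "p = (ricker \<alpha> ^^ n) z"
    have p: "0 < fst p" "0 < snd p" unfolding p_def using ricker_iterate_pos[OF z] by auto
    have nxt: "fst ((ricker \<alpha> ^^ Suc n) z) = snd p"
      "fst ((ricker \<alpha> ^^ Suc (Suc n)) z) = snd p * exp (\<alpha> - fst p)"
      unfolding ricker_iterate p_def by simp_all
    show "log_orbit \<alpha> z (Suc (Suc n)) = log_orbit \<alpha> z (Suc n) - g (log_orbit \<alpha> z n)"
      unfolding log_orbit_def nxt p_def[symmetric] g_def using p \<alpha>
      by (simp add: ln_div ln_mult exp_diff field_simps)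
  qed
qed

lemma ricker_fixed_point: "ricker \<alpha> (\<alpha>, \<alpha>) = (\<alpha>, \<alpha>)"
  by (simp add: ricker_def)

lemma continuous_on_ricker: "continuous_on UNIV (ricker \<alpha>)"
  unfolding ricker_def split_beta by (intro continuous_intros)

lemma continuous_on_ricker_iterate: "continuous_on UNIV (ricker \<alpha> ^^ n)"
proof (induction n)
  case 0
  then show ?case by (simp add: id_def)
next
  case (Suc n)
  have "continuous_on UNIV (ricker \<alpha> \<circ> (ricker \<alpha> ^^ n))"
    by (intro continuous_on_compose Suc continuous_on_subset[OF continuous_on_ricker]) auto
  then show ?case by simp
qed

text \<open>
  Continuity of the first eight iterates at the fixed point puts the first eight terms of nearby
  orbits into the trapping interval.
\<close>
lemma locally_stable_ricker:
  assumes \<alpha>: "0 < \<alpha>" "\<alpha> \<le> 1"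
  shows "locally_stable (ricker \<alpha>) (\<alpha>, \<alpha>)"
  unfolding locally_stable_def
proof (intro conjI allI impI)
  interpret delayed_ricker \<alpha> using \<alpha> by unfold_locales
  let ?p = "(\<alpha>, \<alpha>)"
  show "continuous_on UNIV (ricker \<alpha>)" by (rule continuous_on_ricker)
  show "ricker \<alpha> ?p = ?p" by (rule ricker_fixed_point)
  fix \<epsilon> :: real assume \<epsilon>: "0 < \<epsilon>"
  have "isCont (\<lambda>t. \<alpha> * exp t) 0" by (intro continuous_intros)
  then have "((\<lambda>t. \<alpha> * exp t) \<longlongrightarrow> \<alpha>) (nhds 0)"
    unfolding isCont_def using tendsto_at_iff_tendsto_nhds[of "\<lambda>t. \<alpha> * exp t" 0] by simp
  then obtain r where r: "0 < r" "\<And>t. \<bar>t\<bar> < r \<Longrightarrow> \<bar>\<alpha> * exp t - \<alpha>\<bar> < \<epsilon> / 2"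
    using \<epsilon> unfolding tendsto_iff eventually_nhds_metric dist_real_def by (metis diff_zero half_gt_zero)
  define M where "M = min 1 (r / 5)"
  have M: "0 < M" "M \<le> 1" "4 * M < r" using r(1) by (auto simp: M_def min_def)
  have depth: "0 < depth M" "depth M \<le> 4 * M"
    using g_le_depth[of M] depth_le[of M] g_nonpos_iff[of M] M by (auto simp del: g_nonpos_iff)
  have small: "\<forall>\<^sub>F z in nhds ?p. - depth M \<le> log_orbit \<alpha> z k \<and> log_orbit \<alpha> z k \<le> M" for k
  proof -
    have iter: "(ricker \<alpha> ^^ k) ?p = ?p" by (induction k) (simp_all add: ricker_fixed_point)
    have "isCont (ricker \<alpha> ^^ k) ?p"
      using continuous_on_ricker_iterate[of k \<alpha>] by (simp add: continuous_on_eq_continuous_at)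
    then have "isCont (\<lambda>z. log_orbit \<alpha> z k) ?p"
      unfolding log_orbit_def using \<alpha> iter by (intro continuous_intros) auto
    then have "((\<lambda>z. log_orbit \<alpha> z k) \<longlongrightarrow> 0) (nhds ?p)"
      using \<alpha> iter tendsto_at_iff_tendsto_nhds[of "\<lambda>z. log_orbit \<alpha> z k" ?p]
      by (simp add: isCont_def log_orbit_def)
    then have "\<forall>\<^sub>F z in nhds ?p. - depth M < log_orbit \<alpha> z k" "\<forall>\<^sub>F z in nhds ?p. log_orbit \<alpha> z k < M"
      using depth M by (auto intro: order_tendstoD)
    then show ?thesis by eventually_elim auto
  qed
  have "\<forall>\<^sub>F z in nhds ?p. \<forall>k\<in>{..<8}. - depth M \<le> log_orbit \<alpha> z k \<and> log_orbit \<alpha> z k \<le> M"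
    using small by (intro eventually_ball_finite) auto
  moreover have "\<forall>\<^sub>F z in nhds ?p. 0 < fst z \<and> 0 < snd z"
    using eventually_nhds_in_open[of "{0<..} \<times> {0<..}" ?p] \<alpha>(1)
    by (simp add: open_Times mem_Times_iff)
  ultimately have "\<forall>\<^sub>F z in nhds ?p. \<forall>n. norm ((ricker \<alpha> ^^ n) z - ?p) < \<epsilon>"
  proof eventually_elim
    case (elim z)
    then have z: "0 < fst z" "0 < snd z" by simp_all
    interpret ricker_orbit \<alpha> "log_orbit \<alpha> z"
      using \<alpha> z by (rule ricker_orbit_log_orbit)
    show ?case
    proof
      fix n
      have "\<bar>log_orbit \<alpha> z k\<bar> < r" for k
        using trapped[OF M(1,2), of k] elim(1) depth M by auto
      then have *: "\<bar>\<alpha> * exp (log_orbit \<alpha> z k) - \<alpha>\<bar> < \<epsilon> / 2" for k by (intro r(2))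
      have "norm ((ricker \<alpha> ^^ n) z - ?p)
          \<le> \<bar>\<alpha> * exp (log_orbit \<alpha> z n) - \<alpha>\<bar> + \<bar>\<alpha> * exp (log_orbit \<alpha> z (Suc n)) - \<alpha>\<bar>"
        unfolding ricker_iterate_eq_log_orbit[OF \<alpha>(1) z]
        using norm_Pair_le by (metis diff_Pair real_norm_def)
      then show "norm ((ricker \<alpha> ^^ n) z - ?p) < \<epsilon>" using *[of n] *[of "Suc n"] by linarith
    qed
  qed
  then show "\<exists>\<delta>>0. \<forall>z. norm (z - ?p) < \<delta> \<longrightarrow> (\<forall>n. norm ((ricker \<alpha> ^^ n) z - ?p) < \<epsilon>)"
    by (simp add: eventually_nhds_metric dist_norm)
qed

lemma ricker_iterate_tendsto:
  assumes \<alpha>: "0 < \<alpha>" "\<alpha> \<le> 1" and z: "0 < fst z" "0 < snd z"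
  shows "(\<lambda>n. (ricker \<alpha> ^^ n) z) \<longlonglongrightarrow> (\<alpha>, \<alpha>)"
proof -
  interpret ricker_orbit \<alpha> "log_orbit \<alpha> z" using \<alpha> z by (rule ricker_orbit_log_orbit)
  have "(\<lambda>n. (\<alpha> * exp (log_orbit \<alpha> z n), \<alpha> * exp (log_orbit \<alpha> z (Suc n))))
      \<longlonglongrightarrow> (\<alpha> * exp 0, \<alpha> * exp 0)"
    using tendsto_0 LIMSEQ_Suc[OF tendsto_0] by (intro tendsto_intros)
  then show ?thesis using ricker_iterate_eq_log_orbit[OF \<alpha>(1) z] by simp
qed

theorem theorem1p1:
  fixes \<alpha> :: real
  assumes "0 < \<alpha>" and "\<alpha> \<le> 1"
  shows "locally_stable (ricker \<alpha>) (\<alpha>, \<alpha>) \<and>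
         (\<forall>(x, y) \<in> {0<..} \<times> {0<..}. (\<lambda>n. (ricker \<alpha> ^^ n) (x, y)) \<longlonglongrightarrow> (\<alpha>, \<alpha>))"
  using locally_stable_ricker[OF assms] ricker_iterate_tendsto[OF assms] by auto

end
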